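(* Assume that the second-stage problem has complete recourse and dual strict feasibility (as defined in the context). Let $\Xi=\mathbb R^k$, let $x\in\mathbb R^{n_x}$, $\zeta^1,\dots,\zeta^N\in\Xi$, and let $\underline\epsilon$ be the radius of the 1-Wasserstein ball. Let $v(x)$ be the optimal objective value of $$\min_{\lambda\ge0}\ \underline\epsilon\lambda+\frac1N\sum_{i=1}^N\sup_{\xi\in\Xi}\bigl(Z(x,\xi)-\lambda\|\xi-\zeta^i\|\bigr),$$ and let $v_{SAA}(x)=\frac1N\sum_{i=1}^N Z(x,\zeta^i)$. Then $v(x)$ differs from $v_{SAA}(x)$ by a constant; more specifically, $$v(x)=\underline\epsilon\lambda^*+v_{SAA}(x),$$ where $\lambda^*$ is the optimal solution of the minimization problem $\min_{\lambda\ge0}\ \underline\epsilon\lambda+\frac1N\sum_{i=1}^N\sup_{\xi\in\Xi}\bigl(Z(x,\xi)-\lambda\|\xi-\zeta^i\|\bigr)$.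
   Context: $\|\cdot\|$ is the $l_p$-norm on $\mathbb R^k$ for some $p\in[1,\infty]$. $\mathcal K_y\subseteq\mathbb R^{n_y}$ is a Cartesian product of proper cones, with dual cone $\mathcal K_y^*$. $h:\mathbb R^{n_x}\to\mathbb R^{m_y}$ and $T:\mathbb R^{n_x}\to\mathbb R^{m_y\times k}$ are affine mappings; $q\in\mathbb R^{n_y}$ and $W\in\mathbb R^{m_y\times n_y}$. The second-stage cost is $$Z(x,\xi)=\inf_{y\in\mathcal K_y}\{q^Ty: Wy\ge h(x)+T(x)\xi\},$$ with dual $\sup_{\pi\in\Pi}(h(x)+T(x)\xi)^T\pi$, where $\Pi=\{\pi\ge 0: q-W^T\pi\in\mathcal K_y^*\}$. Complete recourse: for every right-hand side vector of the affine constraints in the second-stage problem (i.e. every vector in place of $h(x)+T(x)\xi$), the second-stage problem is feasible. Dual strict feasibility: the dual problem is feasible and has an interior point (strictly feasible point). The minimization problem over $\lambda$ is the dual of the worst-case expectation problem $\sup_{\mathbb P}\mathbb E_{\mathbb P}[Z(x,\tilde\xi)]$ over the 1-Wasserstein ball of radius $\underline\epsilon$ around the empirical distribution $\frac1N\sum_{i=1}^N\delta_{\zeta^i}$; it is minimized over those $\lambda\ge0$ for which all the inner suprema are finite. *)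

theory Defs
  imports "HOL-Analysis.Analysis"
begin

text \<open>For \<open>p = \<infinity>\<close> this is the maximum norm; \<open>0 powr r = 0\<close> makes the other case correct at zero
  entries.\<close>

definition lp_norm :: "ereal \<Rightarrow> real^'k \<Rightarrow> real" where
  "lp_norm p v =
     (if p = \<infinity> then infnorm v
      else (\<Sum>j\<in>UNIV. \<bar>v $ j\<bar> powr real_of_ereal p) powr (1 / real_of_ereal p))"

definition affine_map :: "('a::real_vector \<Rightarrow> 'b::real_vector) \<Rightarrow> bool" where
  "affine_map f \<longleftrightarrow> (\<exists>L c. linear L \<and> f = (\<lambda>x. L x + c))"

text \<open>A proper cone of the linear subspace \<open>S\<close>; its interior is taken relative to \<open>S\<close>.\<close>

definition proper_cone_in :: "'a::real_normed_vector set \<Rightarrow> 'a set \<Rightarrow> bool" where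
  "proper_cone_in S C \<longleftrightarrow>
     C \<subseteq> S \<and> convex_cone C \<and> closed C \<and> (\<forall>x. x \<in> C \<and> - x \<in> C \<longrightarrow> x = 0) \<and>
     (top_of_set S) interior_of C \<noteq> {}"

text \<open>The factors of a Cartesian product correspond to the blocks \<open>B\<close> of a partition of the
  coordinates. The space \<open>\<real>\<^sup>B\<close> is identified with the vectors that vanish outside \<open>B\<close>.\<close>

definition coord_subspace :: "'n set \<Rightarrow> (real^'n) set" where
  "coord_subspace B = {y. \<forall>i. i \<notin> B \<longrightarrow> y $ i = 0}"

definition coord_proj :: "'n set \<Rightarrow> real^'n \<Rightarrow> real^'n" where
  "coord_proj B y = (\<chi> i. if i \<in> B then y $ i else 0)"

definition product_of_proper_cones :: "(real^'n) set \<Rightarrow> bool" where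
  "product_of_proper_cones K \<longleftrightarrow>
     (\<exists>P C. partition_on UNIV P \<and>
            (\<forall>B\<in>P. proper_cone_in (coord_subspace B) (C B)) \<and>
            K = {y. \<forall>B\<in>P. coord_proj B y \<in> C B})"

definition dual_cone :: "'a::real_inner set \<Rightarrow> 'a set" where
  "dual_cone K = {z. \<forall>y\<in>K. 0 \<le> z \<bullet> y}"

text \<open>The order on \<open>real^'m\<close> is componentwise. The cost is \<open>\<infinity>\<close> for an infeasible and \<open>-\<infinity>\<close> for an
  unbounded problem.\<close>

definition second_stage_cost ::
  "(real^'n) set \<Rightarrow> real^'n \<Rightarrow> real^'n^'m \<Rightarrow> ('x \<Rightarrow> real^'m) \<Rightarrow> ('x \<Rightarrow> real^'k^'m)
     \<Rightarrow> 'x \<Rightarrow> real^'k \<Rightarrow> ereal" where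
  "second_stage_cost K q W h T x \<xi> =
     (INF y\<in>{y \<in> K. h x + T x *v \<xi> \<le> W *v y}. ereal (q \<bullet> y))"

definition complete_recourse :: "(real^'n) set \<Rightarrow> real^'n^'m \<Rightarrow> bool" where
  "complete_recourse K W \<longleftrightarrow> (\<forall>r. \<exists>y\<in>K. r \<le> W *v y)"

text \<open>Note that \<open><\<close> on vectors does not mean strict inequality in every component.\<close>

definition dual_strictly_feasible :: "(real^'n) set \<Rightarrow> real^'n \<Rightarrow> real^'n^'m \<Rightarrow> bool" where
  "dual_strictly_feasible K q W \<longleftrightarrow>
     (\<exists>\<pi>. (\<forall>i. 0 < \<pi> $ i) \<and> q - transpose W *v \<pi> \<in> interior (dual_cone K))"

text \<open>In what follows \<open>z\<close> is the cost function \<open>Z(x, \<cdot>)\<close> at a fixed \<open>x\<close>.\<close>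

definition inner_sup ::
  "ereal \<Rightarrow> (real^'k) set \<Rightarrow> (real^'k \<Rightarrow> ereal) \<Rightarrow> real^'k \<Rightarrow> real \<Rightarrow> ereal" where
  "inner_sup p \<Xi> z \<zeta> lam = (SUP \<xi>\<in>\<Xi>. z \<xi> - ereal (lam * lp_norm p (\<xi> - \<zeta>)))"

definition wass_feasible ::
  "ereal \<Rightarrow> (real^'k) set \<Rightarrow> nat \<Rightarrow> (nat \<Rightarrow> real^'k) \<Rightarrow> (real^'k \<Rightarrow> ereal) \<Rightarrow> real set" where
  "wass_feasible p \<Xi> N \<zeta> z = {lam. 0 \<le> lam \<and> (\<forall>i\<in>{1..N}. \<bar>inner_sup p \<Xi> z (\<zeta> i) lam\<bar> \<noteq> \<infinity>)}"

definition wass_objective ::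
  "ereal \<Rightarrow> real \<Rightarrow> (real^'k) set \<Rightarrow> nat \<Rightarrow> (nat \<Rightarrow> real^'k) \<Rightarrow> (real^'k \<Rightarrow> ereal)
     \<Rightarrow> real \<Rightarrow> ereal" where
  "wass_objective p \<epsilon> \<Xi> N \<zeta> z lam =
     ereal (\<epsilon> * lam) + ereal (1 / real N) * (\<Sum>i=1..N. inner_sup p \<Xi> z (\<zeta> i) lam)"

definition wass_value ::
  "ereal \<Rightarrow> real \<Rightarrow> (real^'k) set \<Rightarrow> nat \<Rightarrow> (nat \<Rightarrow> real^'k) \<Rightarrow> (real^'k \<Rightarrow> ereal) \<Rightarrow> ereal" where
  "wass_value p \<epsilon> \<Xi> N \<zeta> z = (INF lam\<in>wass_feasible p \<Xi> N \<zeta> z. wass_objective p \<epsilon> \<Xi> N \<zeta> z lam)"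

definition wass_optimal ::
  "ereal \<Rightarrow> real \<Rightarrow> (real^'k) set \<Rightarrow> nat \<Rightarrow> (nat \<Rightarrow> real^'k) \<Rightarrow> (real^'k \<Rightarrow> ereal)
     \<Rightarrow> real \<Rightarrow> bool" where
  "wass_optimal p \<epsilon> \<Xi> N \<zeta> z lam \<longleftrightarrow>
     is_arg_min (wass_objective p \<epsilon> \<Xi> N \<zeta> z) (\<lambda>l. l \<in> wass_feasible p \<Xi> N \<zeta> z) lam"

definition saa_value :: "nat \<Rightarrow> (nat \<Rightarrow> real^'k) \<Rightarrow> (real^'k \<Rightarrow> ereal) \<Rightarrow> ereal" where
  "saa_value N \<zeta> z = ereal (1 / real N) * (\<Sum>i=1..N. z (\<zeta> i))"

end

theory Submission
  imports Defs
begin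

text \<open>Complete recourse and weak duality make the second-stage cost \<open>Z(x, \<cdot>)\<close> finite, convex and
  Lipschitz. By convexity along the rays from \<open>\<zeta>\<close>, the function \<open>Z(x, \<xi>) - \<lambda> \<parallel>\<xi> - \<zeta>\<parallel>\<close> is unbounded
  above as soon as it exceeds \<open>Z(x, \<zeta>)\<close> somewhere, so a finite inner supremum equals \<open>Z(x, \<zeta>)\<close>. Hence
  the objective is \<open>\<epsilon> \<lambda> + v\<^sub>S\<^sub>A\<^sub>A\<close> on the feasible set, which is a closed half-line, nonempty by the
  Lipschitz bound.\<close>

section \<open>The \<open>lp_norm\<close>: homogeneity and comparison with the Euclidean
  norm\<close>

lemma lp_norm_0 [simp]: "lp_norm p 0 = 0"
  by (simp add: lp_norm_def infnorm_0)

lemma lp_norm_scaleR: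
  assumes "1 \<le> p" and "0 \<le> t"
  shows "lp_norm p (t *\<^sub>R v) = t * lp_norm p v"
proof (cases "p = \<infinity>")
  case True
  then show ?thesis using assms(2) by (simp add: lp_norm_def infnorm_mul)
next
  case False
  with assms(1) obtain r where p: "p = ereal r" and r: "1 \<le> r" by (cases p) auto
  have "(\<Sum>j\<in>UNIV. \<bar>(t *\<^sub>R v) $ j\<bar> powr r) = t powr r * (\<Sum>j\<in>UNIV. \<bar>v $ j\<bar> powr r)"
    using assms(2) by (simp add: abs_mult powr_mult sum_distrib_left)
  moreover have "(t powr r) powr (1 / r) = t"
    using r assms(2) by (simp add: powr_powr)
  ultimately show ?thesis
    by (simp add: lp_norm_def p powr_mult sum_nonneg)
qed

text \<open>For finite \<open>p\<close>, each \<open>\<bar>v $ j\<bar> powr r\<close> is one term of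
  a sum of nonnegative terms, and taking the root is monotone.\<close>

lemma infnorm_le_lp_norm:
  assumes "1 \<le> p"
  shows "infnorm v \<le> lp_norm p v"
proof (cases "p = \<infinity>")
  case True
  then show ?thesis by (simp add: lp_norm_def)
next
  case False
  with assms obtain r where p: "p = ereal r" and r: "1 \<le> r" by (cases p) auto
  have "\<bar>v $ j\<bar> \<le> lp_norm p v" for j
  proof -
    have "\<bar>v $ j\<bar> = (\<bar>v $ j\<bar> powr r) powr (1 / r)"
      using r by (simp add: powr_powr)
    also have "\<dots> \<le> (\<Sum>j\<in>UNIV. \<bar>v $ j\<bar> powr r) powr (1 / r)"
      using r by (intro powr_mono2 member_le_sum) auto
    finally show ?thesis by (simp add: lp_norm_def p)
  qed
  then show ?thesis
    unfolding infnorm_cart by (intro cSup_least) auto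
qed

text \<open>The maximum norm as intermediary covers all \<open>p\<close> at once. The factor need
  not be sharp: it only enters a Lipschitz constant.\<close>

lemma norm_le_lp_norm:
  fixes v :: "real^'k"
  assumes "1 \<le> p"
  shows "norm v \<le> sqrt DIM(real^'k) * lp_norm p v"
proof -
  have "sqrt DIM(real^'k) * infnorm v \<le> sqrt DIM(real^'k) * lp_norm p v"
    using infnorm_le_lp_norm[OF assms] by (intro mult_left_mono) auto
  with norm_le_infnorm[of v] show ?thesis by linarith
qed

section \<open>The optimal second-stage cost as a function of the right-hand side\<close>

text \<open>Each \<open>coord_proj B\<close> is linear, so the closure conditions can be checked
  factor by factor.\<close>

lemma convex_cone_product_of_proper_cones:
  assumes "product_of_proper_cones K"
  shows "convex_cone K"
proof -
  obtain P C where proper: "\<forall>B\<in>P. proper_cone_in (coord_subspace B) (C B)"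
    and K: "K = {y. \<forall>B\<in>P. coord_proj B y \<in> C B}"
    using assms unfolding product_of_proper_cones_def by (elim exE conjE)
  have C: "convex_cone (C B)" if "B \<in> P" for B
    using bspec[OF proper that] by (simp add: proper_cone_in_def)
  have 0: "coord_proj B 0 = 0" for B
    by (simp add: coord_proj_def vec_eq_iff)
  have add: "coord_proj B (y + z) = coord_proj B y + coord_proj B z" for B y z
    by (simp add: coord_proj_def vec_eq_iff)
  have scale: "coord_proj B (c *\<^sub>R y) = c *\<^sub>R coord_proj B y" for B c y
    by (simp add: coord_proj_def vec_eq_iff)
  show ?thesis
    using C unfolding K convex_cone_iff by (auto simp: 0 add scale)
qed

text \<open>The infimum is taken in the reals; it is meaningful once the feasible set is known to be
  nonempty and the costs bounded below.\<close>

definition recourse_value :: "(real^'n) set \<Rightarrow> real^'n \<Rightarrow> real^'n^'m \<Rightarrow> real^'m \<Rightarrow> real" where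
  "recourse_value K q W r = (INF y\<in>{y \<in> K. r \<le> W *v y}. q \<bullet> y)"

context
  fixes K :: "(real^'n) set" and q :: "real^'n" and W :: "real^'n^'m"
  assumes cone: "convex_cone K" and recourse: "complete_recourse K W"
    and dual: "dual_strictly_feasible K q W"
begin

lemma recourse_nonempty: "{y \<in> K. r \<le> W *v y} \<noteq> {}"
  using recourse by (auto simp: complete_recourse_def)

text \<open>Weak duality: a dual feasible \<open>\<pi>\<close> yields the lower bound
  \<open>\<pi> \<bullet> r\<close>.\<close>

lemma recourse_bdd_below: "bdd_below ((\<lambda>y. q \<bullet> y) ` {y \<in> K. r \<le> W *v y})"
proof -
  obtain \<pi> where pos: "\<And>i. 0 < \<pi> $ i" and "q - transpose W *v \<pi> \<in> interior (dual_cone K)"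
    using dual unfolding dual_strictly_feasible_def by blast
  then have in_dual: "q - transpose W *v \<pi> \<in> dual_cone K"
    using interior_subset by blast
  have "\<pi> \<bullet> r \<le> q \<bullet> y" if "y \<in> K" "r \<le> W *v y" for y
  proof -
    have "\<pi> \<bullet> r \<le> \<pi> \<bullet> (W *v y)"
      unfolding inner_vec_def using that(2) pos
      by (auto intro!: sum_mono mult_left_mono simp: less_eq_vec_def less_imp_le)
    also have "\<dots> = (transpose W *v \<pi>) \<bullet> y"
      by (simp add: dot_lmul_matrix)
    also have "\<dots> \<le> q \<bullet> y"
      using in_dual that(1) by (simp add: dual_cone_def inner_diff_left)
    finally show ?thesis .
  qed
  then show ?thesis by (auto simp: bdd_below_def)
qed

lemma recourse_value_le: "y \<in> K \<Longrightarrow> r \<le> W *v y \<Longrightarrow> recourse_value K q W r \<le> q \<bullet> y"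
  unfolding recourse_value_def using recourse_bdd_below by (intro cINF_lower) auto

text \<open>Near-optimal points stand in for minimizers in the convexity and Lipschitz proofs, which
  absorb \<open>e\<close> by \<open>field_le_epsilon\<close>.\<close>

lemma recourse_value_approx:
  assumes "0 < e"
  obtains y where "y \<in> K" "r \<le> W *v y" "q \<bullet> y < recourse_value K q W r + e"
proof -
  have "(INF y\<in>{y \<in> K. r \<le> W *v y}. q \<bullet> y) < recourse_value K q W r + e"
    using assms by (simp add: recourse_value_def)
  then show ?thesis
    unfolding cINF_less_iff[OF recourse_nonempty recourse_bdd_below] using that by blast
qed

lemma second_stage_cost_eq:
  "second_stage_cost K q W h T x \<xi> = ereal (recourse_value K q W (h x + T x *v \<xi>))"
proof -
  let ?r = "h x + T x *v \<xi>"
  show ?thesis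
    unfolding second_stage_cost_def recourse_value_def
    using ereal_Inf'[OF recourse_bdd_below, of ?r] recourse_nonempty[of ?r]
    by (simp add: image_comp)
qed

text \<open>Near-optimal points for \<open>r\<close> and \<open>s\<close> combine to a feasible
  point for the same combination of \<open>r\<close> and \<open>s\<close>, and the cost is
  linear.\<close>

lemma convex_on_recourse_value: "convex_on UNIV (recourse_value K q W)"
proof
  fix t :: real and r s :: "real^'m"
  assume t: "0 < t" "t < 1"
  show "recourse_value K q W ((1 - t) *\<^sub>R r + t *\<^sub>R s)
      \<le> (1 - t) * recourse_value K q W r + t * recourse_value K q W s"
  proof (rule field_le_epsilon)
    fix e :: real
    assume e: "0 < e"
    obtain y where y: "y \<in> K" "r \<le> W *v y" "q \<bullet> y < recourse_value K q W r + e"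
      using e by (rule recourse_value_approx)
    obtain z where z: "z \<in> K" "s \<le> W *v z" "q \<bullet> z < recourse_value K q W s + e"
      using e by (rule recourse_value_approx)
    let ?w = "(1 - t) *\<^sub>R y + t *\<^sub>R z"
    have "?w \<in> K"
      using cone y(1) z(1) t by (simp add: convex_cone_add convex_cone_scaleR)
    moreover have "(1 - t) *\<^sub>R r + t *\<^sub>R s \<le> W *v ?w"
      using t y(2) z(2)
      by (auto simp: less_eq_vec_def matrix_vector_right_distrib linear_scale[OF matrix_vector_mul_linear]
          intro!: add_mono mult_left_mono)
    ultimately have "recourse_value K q W ((1 - t) *\<^sub>R r + t *\<^sub>R s) \<le> q \<bullet> ?w"
      by (rule recourse_value_le)
    also have "\<dots> = (1 - t) * (q \<bullet> y) + t * (q \<bullet> z)"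
      by (simp add: inner_add_right)
    also have "\<dots> \<le> (1 - t) * (recourse_value K q W r + e) + t * (recourse_value K q W s + e)"
      using t y(3) z(3) by (intro add_mono mult_left_mono) auto
    finally show "recourse_value K q W ((1 - t) *\<^sub>R r + t *\<^sub>R s)
        \<le> (1 - t) * recourse_value K q W r + t * recourse_value K q W s + e"
      by (simp add: algebra_simps)
  qed
qed simp

text \<open>If \<open>y\<close> is feasible for \<open>s\<close> and \<open>u\<close> is feasible for the all-ones vector, then
  \<open>y + \<parallel>r - s\<parallel> u\<close> is feasible for \<open>r\<close>.\<close>

lemma recourse_value_lipschitz:
  obtains L where "0 \<le> L" "\<And>r s. recourse_value K q W r \<le> recourse_value K q W s + L * norm (r - s)"
proof -
  obtain u where u: "u \<in> K" "1 \<le> W *v u"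
    using recourse unfolding complete_recourse_def by blast
  \<comment> \<open>The added multiple of \<open>u\<close> costs \<open>q \<bullet> u\<close> per
    unit, possibly negative; the absolute value secures \<open>0 \<le> L\<close>.\<close>
  have "recourse_value K q W r \<le> recourse_value K q W s + \<bar>q \<bullet> u\<bar> * norm (r - s)" for r s
  proof (rule field_le_epsilon)
    fix e :: real
    assume "0 < e"
    then obtain y where y: "y \<in> K" "s \<le> W *v y" "q \<bullet> y < recourse_value K q W s + e"
      by (rule recourse_value_approx)
    let ?w = "y + norm (r - s) *\<^sub>R u"
    have "?w \<in> K"
      using cone y(1) u(1) by (simp add: convex_cone_add convex_cone_scaleR)
    moreover have "r \<le> W *v ?w"
      unfolding less_eq_vec_def
    proof
      fix i
      have "r $ i = s $ i + (r - s) $ i" by simp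
      also have "\<dots> \<le> (W *v y) $ i + norm (r - s) * 1"
        using y(2) component_le_norm_cart[of "r - s" i]
        by (intro add_mono) (auto simp: less_eq_vec_def)
      also have "\<dots> \<le> (W *v y) $ i + norm (r - s) * (W *v u) $ i"
        using u(2) by (intro add_mono mult_left_mono) (auto simp: less_eq_vec_def)
      also have "\<dots> = (W *v ?w) $ i"
        by (simp add: matrix_vector_right_distrib linear_scale[OF matrix_vector_mul_linear])
      finally show "r $ i \<le> (W *v ?w) $ i" .
    qed
    ultimately have "recourse_value K q W r \<le> q \<bullet> ?w"
      by (rule recourse_value_le)
    also have "\<dots> = q \<bullet> y + (q \<bullet> u) * norm (r - s)"
      by (simp add: inner_add_right)
    also have "\<dots> \<le> q \<bullet> y + \<bar>q \<bullet> u\<bar> * norm (r - s)"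
      by (intro add_left_mono mult_right_mono) auto
    finally show "recourse_value K q W r \<le> recourse_value K q W s + \<bar>q \<bullet> u\<bar> * norm (r - s) + e"
      using y(3) by linarith
  qed
  then show ?thesis using that[of "\<bar>q \<bullet> u\<bar>"] by simp
qed

text \<open>Convexity and the Lipschitz bound pass through the affine map from \<open>\<xi>\<close>
  to \<open>h x + T x *v \<xi>\<close>. The sign of \<open>L\<close> lets it serve later as a
  feasible multiplier.\<close>

lemma second_stage_cost_convex_lipschitz:
  fixes T :: "'x \<Rightarrow> real^'k^'m"
  assumes "1 \<le> p"
  obtains f L where "second_stage_cost K q W h T x = (\<lambda>\<xi>. ereal (f \<xi>))"
    and "convex_on UNIV f" and "0 \<le> L" and "\<forall>\<xi> \<eta>. f \<xi> \<le> f \<eta> + L * lp_norm p (\<xi> - \<eta>)"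
proof -
  define f where "f \<xi> = recourse_value K q W (h x + T x *v \<xi>)" for \<xi>
  obtain L where L: "0 \<le> L"
    "\<And>r s. recourse_value K q W r \<le> recourse_value K q W s + L * norm (r - s)"
    using recourse_value_lipschitz by blast
  obtain B where B: "0 < B" "\<And>v. norm (T x *v v) \<le> B * norm v"
    using linear_bounded_pos[OF matrix_vector_mul_linear[of "T x"]] by blast
  \<comment> \<open>The factors come from the recourse value, the matrix \<open>T x\<close> and the
    change of norm.\<close>
  let ?M = "L * (B * sqrt DIM(real^'k))"
  have "convex_on UNIV f"
  proof
    fix t :: real and \<xi> \<eta>
    assume t: "0 < t" "t < 1"
    have "h x + T x *v ((1 - t) *\<^sub>R \<xi> + t *\<^sub>R \<eta>)
        = (1 - t) *\<^sub>R (h x + T x *v \<xi>) + t *\<^sub>R (h x + T x *v \<eta>)"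
      by (simp add: matrix_vector_right_distrib linear_scale[OF matrix_vector_mul_linear]
          algebra_simps)
    then show "f ((1 - t) *\<^sub>R \<xi> + t *\<^sub>R \<eta>) \<le> (1 - t) * f \<xi> + t * f \<eta>"
      unfolding f_def using convex_onD[OF convex_on_recourse_value, of t] t by simp
  qed simp
  moreover have "f \<xi> \<le> f \<eta> + ?M * lp_norm p (\<xi> - \<eta>)" for \<xi> \<eta>
  proof -
    have "norm (T x *v (\<xi> - \<eta>)) \<le> B * (sqrt DIM(real^'k) * lp_norm p (\<xi> - \<eta>))"
      using B norm_le_lp_norm[OF assms, of "\<xi> - \<eta>"]
      by (meson mult_left_mono less_imp_le order_trans)
    then have "L * norm (T x *v (\<xi> - \<eta>)) \<le> L * (B * (sqrt DIM(real^'k) * lp_norm p (\<xi> - \<eta>)))"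
      using L(1) by (rule mult_left_mono)
    moreover have "f \<xi> \<le> f \<eta> + L * norm (T x *v (\<xi> - \<eta>))"
      unfolding f_def
      using L(2)[of "h x + T x *v \<xi>" "h x + T x *v \<eta>"] by (simp add: matrix_vector_mult_diff_distrib)
    ultimately show ?thesis by (simp add: mult.assoc)
  qed
  moreover have "0 \<le> ?M" using L(1) B(1) by simp
  moreover have "second_stage_cost K q W h T x = (\<lambda>\<xi>. ereal (f \<xi>))"
    by (simp add: f_def fun_eq_iff second_stage_cost_eq)
  ultimately show ?thesis
    using that[of f ?M] by simp
qed

end

section \<open>Finiteness and value of the inner suprema\<close>

text \<open>If the bound fails at \<open>\<xi>\<close> by \<open>d\<close>, convexity makes it fail
  by at least \<open>t * d\<close> after stretching \<open>\<xi> - \<zeta>\<close> by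
  \<open>t\<close>, which beats every \<open>C\<close>.\<close>

lemma convex_bounded_growth:
  assumes p: "1 \<le> p" and f: "convex_on UNIV f"
    and C: "\<And>\<xi>. f \<xi> - lam * lp_norm p (\<xi> - \<zeta>) \<le> C"
  shows "f \<xi> \<le> f \<zeta> + lam * lp_norm p (\<xi> - \<zeta>)"
proof (rule ccontr)
  define d where "d = f \<xi> - f \<zeta> - lam * lp_norm p (\<xi> - \<zeta>)"
  assume "\<not> ?thesis"
  then have d: "0 < d" by (simp add: d_def)
  \<comment> \<open>\<open>1 \<le> t\<close> puts \<open>\<xi>\<close> on the segment from
    \<open>\<zeta>\<close> to the stretched point; the quotient forces
    \<open>C < f \<zeta> + t * d\<close>.\<close>
  define t where "t = max 1 ((\<bar>C\<bar> + \<bar>f \<zeta>\<bar> + 1) / d)"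
  have t: "1 \<le> t" by (simp add: t_def)
  have "(\<bar>C\<bar> + \<bar>f \<zeta>\<bar> + 1) / d \<le> t" by (simp add: t_def)
  then have td: "\<bar>C\<bar> + \<bar>f \<zeta>\<bar> + 1 \<le> t * d"
    using d by (simp add: pos_divide_le_eq)
  let ?\<eta> = "\<zeta> + t *\<^sub>R (\<xi> - \<zeta>)"
  have "(1 - 1 / t) *\<^sub>R \<zeta> + (1 / t) *\<^sub>R ?\<eta> = \<xi>"
    using t by (simp add: algebra_simps)
  then have "f \<xi> \<le> (1 - 1 / t) * f \<zeta> + 1 / t * f ?\<eta>"
    using convex_onD[OF f, of "1 / t" \<zeta> ?\<eta>] t by simp
  then have "t * f \<xi> \<le> t * ((1 - 1 / t) * f \<zeta> + 1 / t * f ?\<eta>)"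
    using t by (intro mult_left_mono) auto
  also have "\<dots> = (t - 1) * f \<zeta> + f ?\<eta>"
    using t by (simp add: field_simps)
  finally have "t * f \<xi> \<le> (t - 1) * f \<zeta> + f ?\<eta>" .
  moreover have "f ?\<eta> - lam * (t * lp_norm p (\<xi> - \<zeta>)) \<le> C"
    using C[of ?\<eta>] lp_norm_scaleR[OF p, of t "\<xi> - \<zeta>"] t by simp
  ultimately have "f \<zeta> + t * d \<le> C"
    by (simp add: d_def algebra_simps)
  with td show False by linarith
qed

text \<open>The supremum is attained at \<open>\<xi> = \<zeta>\<close>, where the penalty
  vanishes.\<close>

lemma inner_sup_eq:
  assumes "\<And>\<xi>. f \<xi> \<le> f \<zeta> + lam * lp_norm p (\<xi> - \<zeta>)"
  shows "inner_sup p UNIV (\<lambda>\<xi>. ereal (f \<xi>)) \<zeta> lam = ereal (f \<zeta>)"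
  unfolding inner_sup_def
proof (rule antisym)
  show "(SUP \<xi>. ereal (f \<xi>) - ereal (lam * lp_norm p (\<xi> - \<zeta>))) \<le> ereal (f \<zeta>)"
    using assms by (intro SUP_least) (simp add: diff_le_eq)
  show "ereal (f \<zeta>) \<le> (SUP \<xi>. ereal (f \<xi>) - ereal (lam * lp_norm p (\<xi> - \<zeta>)))"
    by (rule SUP_upper2[of \<zeta>]) auto
qed

lemma inner_sup_finite_iff:
  assumes "1 \<le> p" and "convex_on UNIV f"
  shows "\<bar>inner_sup p UNIV (\<lambda>\<xi>. ereal (f \<xi>)) \<zeta> lam\<bar> \<noteq> \<infinity> \<longleftrightarrow>
    (\<forall>\<xi>. f \<xi> \<le> f \<zeta> + lam * lp_norm p (\<xi> - \<zeta>))"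
proof
  assume "\<bar>inner_sup p UNIV (\<lambda>\<xi>. ereal (f \<xi>)) \<zeta> lam\<bar> \<noteq> \<infinity>"
  \<comment> \<open>The finite supremum itself is the bound required by
    \<open>convex_bounded_growth\<close>.\<close>
  then obtain C where C: "inner_sup p UNIV (\<lambda>\<xi>. ereal (f \<xi>)) \<zeta> lam = ereal C"
    by (cases "inner_sup p UNIV (\<lambda>\<xi>. ereal (f \<xi>)) \<zeta> lam") auto
  have "ereal (f \<xi> - lam * lp_norm p (\<xi> - \<zeta>)) \<le> ereal C" for \<xi>
    unfolding C[symmetric] inner_sup_def by (rule SUP_upper2[of \<xi>]) auto
  then have "\<And>\<xi>. f \<xi> - lam * lp_norm p (\<xi> - \<zeta>) \<le> C"
    by simp
  then show "\<forall>\<xi>. f \<xi> \<le> f \<zeta> + lam * lp_norm p (\<xi> - \<zeta>)"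
    using convex_bounded_growth[OF assms] by blast
qed (simp add: inner_sup_eq)

section \<open>The feasible multipliers and the objective on them\<close>

lemma wass_feasible_convex:
  assumes "1 \<le> p" and "convex_on UNIV f"
  shows "wass_feasible p UNIV N \<zeta> (\<lambda>\<xi>. ereal (f \<xi>)) =
    {lam. 0 \<le> lam \<and> (\<forall>i\<in>{1..N}. \<forall>\<xi>. f \<xi> \<le> f (\<zeta> i) + lam * lp_norm p (\<xi> - \<zeta> i))}"
  unfolding wass_feasible_def inner_sup_finite_iff[OF assms] ..

lemma wass_objective_convex:
  assumes "1 \<le> p" and "convex_on UNIV f"
    and "lam \<in> wass_feasible p UNIV N \<zeta> (\<lambda>\<xi>. ereal (f \<xi>))"
  shows "wass_objective p \<epsilon> UNIV N \<zeta> (\<lambda>\<xi>. ereal (f \<xi>)) lam =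
    ereal (\<epsilon> * lam) + saa_value N \<zeta> (\<lambda>\<xi>. ereal (f \<xi>))"
proof -
  have "inner_sup p UNIV (\<lambda>\<xi>. ereal (f \<xi>)) (\<zeta> i) lam = ereal (f (\<zeta> i))" if "i \<in> {1..N}" for i
    using assms(3) that unfolding wass_feasible_convex[OF assms(1,2)] by (intro inner_sup_eq) auto
  then show ?thesis
    unfolding wass_objective_def saa_value_def by simp
qed

text \<open>The constraints are non-strict and affine in \<open>lam\<close>, so the feasible set is
  closed; it contains \<open>L\<close> and is bounded below by 0, hence contains its
  infimum.\<close>

lemma wass_feasible_has_least:
  assumes "1 \<le> p" and "convex_on UNIV f"
    and "0 \<le> L" and "\<forall>\<xi> \<eta>. f \<xi> \<le> f \<eta> + L * lp_norm p (\<xi> - \<eta>)"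
  obtains lam where "lam \<in> wass_feasible p UNIV N \<zeta> (\<lambda>\<xi>. ereal (f \<xi>))"
    and "\<forall>l\<in>wass_feasible p UNIV N \<zeta> (\<lambda>\<xi>. ereal (f \<xi>)). lam \<le> l"
proof -
  let ?F = "wass_feasible p UNIV N \<zeta> (\<lambda>\<xi>. ereal (f \<xi>))"
  have F: "?F = {0..} \<inter> (\<Inter>i\<in>{1..N}. \<Inter>\<xi>. {lam. f \<xi> \<le> f (\<zeta> i) + lam * lp_norm p (\<xi> - \<zeta> i)})"
    unfolding wass_feasible_convex[OF assms(1,2)] by auto
  have "closed ?F"
    unfolding F by (intro closed_Int closed_INT ballI closed_Collect_le continuous_intros closed_atLeast)
  moreover have "L \<in> ?F"
    using assms(3,4) unfolding F by auto
  moreover have bdd: "bdd_below ?F"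
    unfolding F by (rule bdd_belowI[of _ 0]) auto
  ultimately have "Inf ?F \<in> ?F"
    by (intro closed_contains_Inf) auto
  with bdd show ?thesis
    by (intro that) (auto intro: cInf_lower)
qed

theorem corollary3p8:
  fixes p :: ereal and \<epsilon> :: real
    and K :: "(real^'ny) set" and q :: "real^'ny" and W :: "real^'ny^'my"
    and h :: "real^'nx \<Rightarrow> real^'my" and T :: "real^'nx \<Rightarrow> real^'k^'my"
    and \<Xi> :: "(real^'k) set" and x :: "real^'nx"
    and N :: nat and \<zeta> :: "nat \<Rightarrow> real^'k"
  assumes "1 \<le> p"
    and "product_of_proper_cones K"
    and "affine_map h" and "affine_map T"
    and "complete_recourse K W"
    and "dual_strictly_feasible K q W"
    and "\<Xi> = UNIV"
    and "1 \<le> N" and "\<forall>i\<in>{1..N}. \<zeta> i \<in> \<Xi>"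
    and "0 \<le> \<epsilon>"
  shows "(\<exists>lam_opt. wass_optimal p \<epsilon> \<Xi> N \<zeta> (second_stage_cost K q W h T x) lam_opt) \<and>
    (\<forall>lam_opt. wass_optimal p \<epsilon> \<Xi> N \<zeta> (second_stage_cost K q W h T x) lam_opt \<longrightarrow>
       wass_value p \<epsilon> \<Xi> N \<zeta> (second_stage_cost K q W h T x) =
         ereal (\<epsilon> * lam_opt) + saa_value N \<zeta> (second_stage_cost K q W h T x))"
proof -
  let ?z = "second_stage_cost K q W h T x"
  let ?F = "wass_feasible p \<Xi> N \<zeta> ?z" and ?obj = "wass_objective p \<epsilon> \<Xi> N \<zeta> ?z"
  obtain f L where z: "?z = (\<lambda>\<xi>. ereal (f \<xi>))" and f: "convex_on UNIV f"
    and L: "0 \<le> L" "\<forall>\<xi> \<eta>. f \<xi> \<le> f \<eta> + L * lp_norm p (\<xi> - \<eta>)"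
    by (rule second_stage_cost_convex_lipschitz[where h = h and T = T and x = x,
          OF convex_cone_product_of_proper_cones[OF assms(2)] assms(5,6,1)])
  have obj: "?obj l = ereal (\<epsilon> * l) + saa_value N \<zeta> ?z" if "l \<in> ?F" for l
    using that unfolding z \<open>\<Xi> = UNIV\<close> by (rule wass_objective_convex[OF assms(1) f])
  obtain lam where lam: "lam \<in> ?F" "\<forall>l\<in>?F. lam \<le> l"
    unfolding z \<open>\<Xi> = UNIV\<close> by (rule wass_feasible_has_least[OF assms(1) f L])
  \<comment> \<open>On \<open>?F\<close> the objective is \<open>\<epsilon> * l\<close> plus a
    constant, hence nondecreasing as \<open>0 \<le> \<epsilon>\<close>.\<close>
  have "?obj lam \<le> ?obj l" if "l \<in> ?F" for l
    using obj[OF that] obj[OF lam(1)] bspec[OF lam(2) that] \<open>0 \<le> \<epsilon>\<close>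
    by (simp add: add_right_mono mult_left_mono)
  then have "wass_optimal p \<epsilon> \<Xi> N \<zeta> ?z lam"
    using lam(1) by (auto simp: wass_optimal_def is_arg_min_linorder)
  \<comment> \<open>An arbitrary minimizer is treated, since for \<open>\<epsilon> = 0\<close> every
    element of \<open>?F\<close> is optimal.\<close>
  moreover have "wass_value p \<epsilon> \<Xi> N \<zeta> ?z = ereal (\<epsilon> * l) + saa_value N \<zeta> ?z"
    if "wass_optimal p \<epsilon> \<Xi> N \<zeta> ?z l" for l
  proof -
    have l: "l \<in> ?F" and min: "\<And>m. m \<in> ?F \<Longrightarrow> ?obj l \<le> ?obj m"
      using that by (auto simp: wass_optimal_def is_arg_min_linorder)
    have "wass_value p \<epsilon> \<Xi> N \<zeta> ?z = ?obj l"
      unfolding wass_value_def using l min by (intro antisym INF_lower INF_greatest)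
    with obj[OF l] show ?thesis by simp
  qed
  ultimately show ?thesis by blast
qed

end
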